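(* Let $(u,v)$ be a nonnegative classical solution of the Neumann problem $$\begin{cases}\Delta[(d_1+a_{11}u)u]+u(1-u-a_1v)=0, & x\in\Omega,\\ \Delta[(d_2+a_{22}v)v]+v(1-a_2u-v)=0, & x\in\Omega,\\ \dfrac{\partial u}{\partial\nu}=\dfrac{\partial v}{\partial\nu}=0, & x\in\partial\Omega.\end{cases}$$ Suppose that either (i) $a_1>1>a_2$, $d_1>d_2$ and $d_1\ge d_2+2a_{22}$, or (ii) $a_1<1<a_2$, $d_1<d_2$ and $d_2\ge d_1+2a_{11}$. Then the system has no coexisting solutions, that is, $u\equiv 0$ or $v\equiv 0$ in $\Omega$ (at least one species is extinct).
   Context: $\Omega\subset\mathbb{R}^n$ ($n\ge1$) is a bounded domain with smooth boundary satisfying the interior ball condition at every boundary point, and $\nu$ is the outward unit normal on $\partial\Omega$. The constants satisfy $a_1,a_2,d_1,d_2>0$ and $a_{11},a_{22}\ge0$. A nonnegative classical solution is a pair $(u,v)\in (C^1(\overline\Omega)\cap C^2(\Omega))^2$ with $u,v\ge0$ in $\overline\Omega$ satisfying the system (equations and boundary conditions) pointwise. A coexisting solution is a nonnegative classical solution with $u\not\equiv0$ and $v\not\equiv0$. *)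

theory Defs
  imports "HOL-Analysis.Analysis"
begin

text \<open>
  The space \<open>\<real>\<^sup>n\<close> with \<open>n \<ge> 1\<close> is an arbitrary type \<open>'a :: euclidean_space\<close>. Functions on
  \<open>\<Omega>\<close> or its closure are total functions whose values elsewhere are irrelevant.
\<close>

text \<open>\<open>C\<^sup>k\<close> on an open set \<open>S\<close>; for \<open>S\<close> that is not open this is not meaningful.\<close>

primrec Ck_on :: "nat \<Rightarrow> 'a::euclidean_space set \<Rightarrow> ('a \<Rightarrow> real) \<Rightarrow> bool" where
  "Ck_on 0 S f \<longleftrightarrow> continuous_on S f"
| "Ck_on (Suc k) S f \<longleftrightarrow>
     (\<exists>g. (\<forall>x\<in>S. GDERIV f x :> g x) \<and> (\<forall>i\<in>Basis. Ck_on k S (\<lambda>x. g x \<bullet> i)))"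

definition smooth_on :: "'a::euclidean_space set \<Rightarrow> ('a \<Rightarrow> real) \<Rightarrow> bool" where
  "smooth_on S f \<longleftrightarrow> (\<forall>k. Ck_on k S f)"

text \<open>
  \<open>C\<^sup>1\<close> up to the boundary: \<open>u\<close> is continuous on the closure, and its gradient in \<open>\<Omega>\<close>
  extends continuously to the closure.
\<close>

definition C1_closure :: "'a::euclidean_space set \<Rightarrow> ('a \<Rightarrow> real) \<Rightarrow> bool" where
  "C1_closure \<Omega> u \<longleftrightarrow> continuous_on (closure \<Omega>) u \<and>
     (\<exists>G. continuous_on (closure \<Omega>) G \<and> (\<forall>x\<in>\<Omega>. GDERIV u x :> G x))"

definition laplacian :: "('a::euclidean_space \<Rightarrow> real) \<Rightarrow> 'a \<Rightarrow> real" where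
  "laplacian f x = (\<Sum>i\<in>Basis. (deriv ^^ 2) (\<lambda>t. f (x + t *\<^sub>R i)) 0)"

text \<open>Near its zero set in \<open>U\<close>, \<open>\<phi>\<close> is a smooth defining function, negative exactly inside \<open>\<Omega>\<close>.\<close>

definition local_defining_function ::
    "'a::euclidean_space set \<Rightarrow> 'a set \<Rightarrow> ('a \<Rightarrow> real) \<Rightarrow> bool" where
  "local_defining_function \<Omega> U \<phi> \<longleftrightarrow>
     open U \<and> smooth_on U \<phi> \<and>
     \<Omega> \<inter> U = {x \<in> U. \<phi> x < 0} \<and>
     frontier \<Omega> \<inter> U = {x \<in> U. \<phi> x = 0} \<and>
     (\<forall>x\<in>U. \<phi> x = 0 \<longrightarrow> \<not> (GDERIV \<phi> x :> 0))"

definition smooth_boundary :: "'a::euclidean_space set \<Rightarrow> bool" where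
  "smooth_boundary \<Omega> \<longleftrightarrow>
     (\<forall>p\<in>frontier \<Omega>. \<exists>U \<phi>. p \<in> U \<and> local_defining_function \<Omega> U \<phi>)"

text \<open>
  The outward unit normal is the normalized gradient of a local defining function; it does
  not depend on the choice of that function. (\<open>sgn g\<close> is \<open>g\<close> divided by its norm.)
\<close>

definition outward_unit_normal :: "'a::euclidean_space set \<Rightarrow> 'a \<Rightarrow> 'a \<Rightarrow> bool" where
  "outward_unit_normal \<Omega> p n \<longleftrightarrow>
     (\<exists>U \<phi> g. p \<in> U \<and> local_defining_function \<Omega> U \<phi> \<and> (GDERIV \<phi> p :> g) \<and> n = sgn g)"

definition interior_ball_condition :: "'a::euclidean_space set \<Rightarrow> 'a \<Rightarrow> bool" where
  "interior_ball_condition \<Omega> p \<longleftrightarrow> (\<exists>c r. r > 0 \<and> ball c r \<subseteq> \<Omega> \<and> p \<in> sphere c r)"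

definition smooth_bounded_domain :: "'a::euclidean_space set \<Rightarrow> bool" where
  "smooth_bounded_domain \<Omega> \<longleftrightarrow>
     open \<Omega> \<and> connected \<Omega> \<and> \<Omega> \<noteq> {} \<and> bounded \<Omega> \<and> smooth_boundary \<Omega> \<and>
     (\<forall>p\<in>frontier \<Omega>. interior_ball_condition \<Omega> p)"

text \<open>
  Directional derivative of \<open>u\<close> at the boundary point \<open>x\<close> in the outward normal direction \<open>n\<close>.
  It is one-sided, since \<open>x + t *\<^sub>R n\<close> lies in \<open>\<Omega>\<close> only for small \<open>t < 0\<close>. For \<open>u\<close> that is
  \<open>C\<^sup>1\<close> up to the boundary it is the inner product of \<open>n\<close> with the extended gradient.
\<close>

definition has_normal_derivative ::
    "('a::euclidean_space \<Rightarrow> real) \<Rightarrow> real \<Rightarrow> 'a \<Rightarrow> 'a \<Rightarrow> bool" where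
  "has_normal_derivative u D x n \<longleftrightarrow>
     ((\<lambda>t. u (x + t *\<^sub>R n)) has_real_derivative D) (at 0 within {..0})"

definition nonneg_classical_solution ::
    "'a::euclidean_space set \<Rightarrow> ('a \<Rightarrow> 'a) \<Rightarrow> real \<Rightarrow> real \<Rightarrow> real \<Rightarrow> real \<Rightarrow> real \<Rightarrow> real \<Rightarrow>
      ('a \<Rightarrow> real) \<Rightarrow> ('a \<Rightarrow> real) \<Rightarrow> bool" where
  "nonneg_classical_solution \<Omega> \<nu> d1 d2 a11 a22 a1 a2 u v \<longleftrightarrow>
     C1_closure \<Omega> u \<and> Ck_on 2 \<Omega> u \<and> C1_closure \<Omega> v \<and> Ck_on 2 \<Omega> v \<and>
     (\<forall>x\<in>closure \<Omega>. u x \<ge> 0 \<and> v x \<ge> 0) \<and>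
     (\<forall>x\<in>\<Omega>. laplacian (\<lambda>y. (d1 + a11 * u y) * u y) x + u x * (1 - u x - a1 * v x) = 0) \<and>
     (\<forall>x\<in>\<Omega>. laplacian (\<lambda>y. (d2 + a22 * v y) * v y) x + v x * (1 - a2 * u x - v x) = 0) \<and>
     (\<forall>x\<in>frontier \<Omega>. has_normal_derivative u 0 x (\<nu> x) \<and> has_normal_derivative v 0 x (\<nu> x))"

end

theory Submission
  imports Defs
begin

text \<open>
  Say \<open>a\<^sub>2 < 1 < a\<^sub>1\<close> and suppose both species coexist. Since \<open>(d\<^sub>1 + a\<^sub>1\<^sub>1 u) u\<close> is increasing
  in \<open>u \<ge> 0\<close>, the maximum principle (with Hopf's lemma on the boundary) at a maximum \<open>x\<^sub>0\<close> of \<open>u\<close>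
  gives \<open>u(x\<^sub>0) + a\<^sub>1 v(x\<^sub>0) \<le> 1\<close>. By the strong maximum principle \<open>v > 0\<close> on the closure, so at a
  minimum \<open>x\<^sub>1\<close> of \<open>v\<close> likewise \<open>a\<^sub>2 u(x\<^sub>1) + v(x\<^sub>1) \<ge> 1\<close>. Hence
  \<open>u(x\<^sub>0) + a\<^sub>1 v(x\<^sub>0) \<le> 1 \<le> a\<^sub>2 u(x\<^sub>1) + v(x\<^sub>1) \<le> a\<^sub>2 u(x\<^sub>0) + v(x\<^sub>0)\<close>, which forces \<open>u(x\<^sub>0) = 0\<close>.
\<close>

section \<open>Second derivatives along lines and the Laplacian\<close>

text \<open>\<open>deriv\<close> is total, so the value of \<open>(deriv ^^ 2) f 0\<close> says
  nothing about differentiability. This predicate records existence as well: a first derivative in a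
  neighbourhood of 0, itself differentiable at 0.\<close>

definition has_second_derivative :: "(real \<Rightarrow> real) \<Rightarrow> real \<Rightarrow> bool" where
  "has_second_derivative f D \<longleftrightarrow>
     (\<exists>f'. (\<forall>\<^sub>F t in nhds 0. (f has_real_derivative f' t) (at t)) \<and>
           (f' has_real_derivative D) (at 0))"

lemma has_second_derivative_imp_deriv:
  assumes "has_second_derivative f D"
  shows "(deriv ^^ 2) f 0 = D"
proof -
  obtain f' where f': "\<forall>\<^sub>F t in nhds 0. (f has_real_derivative f' t) (at t)"
    and D: "(f' has_real_derivative D) (at 0)"
    using assms by (auto simp: has_second_derivative_def)
  have "\<forall>\<^sub>F t in nhds 0. deriv f t = f' t"
    using f' by eventually_elim (rule DERIV_imp_deriv)
  then have "deriv (deriv f) 0 = deriv f' 0"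
    by (intro deriv_cong_ev) auto
  then show ?thesis
    using D by (simp add: numeral_2_eq_2 DERIV_imp_deriv)
qed

text \<open>The shape \<open>f - c * g\<close> covers every linear combination used later:
  subtracting a multiple of a barrier, subtracting a constant (\<open>c = 1\<close>), and changing
  sign (\<open>f = 0\<close>, \<open>c = 1\<close>).\<close>

lemma has_second_derivative_diff_cmult:
  assumes "has_second_derivative f D" "has_second_derivative g E"
  shows "has_second_derivative (\<lambda>t. f t - c * g t) (D - c * E)"
proof -
  obtain f' g' where f': "\<forall>\<^sub>F t in nhds 0. (f has_real_derivative f' t) (at t)"
    and D: "(f' has_real_derivative D) (at 0)"
    and g': "\<forall>\<^sub>F t in nhds 0. (g has_real_derivative g' t) (at t)"
    and E: "(g' has_real_derivative E) (at 0)"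
    using assms by (auto simp: has_second_derivative_def)
  have "\<forall>\<^sub>F t in nhds 0. ((\<lambda>t. f t - c * g t) has_real_derivative f' t - c * g' t) (at t)"
    using f' g' by eventually_elim (auto intro!: derivative_eq_intros)
  moreover have "((\<lambda>t. f' t - c * g' t) has_real_derivative D - c * E) (at 0)"
    using D E by (auto intro!: derivative_eq_intros)
  ultimately show ?thesis
    unfolding has_second_derivative_def by (intro exI[of _ "\<lambda>t. f' t - c * g' t"]) simp
qed

lemma has_second_derivative_const: "has_second_derivative (\<lambda>t. c) 0"
  unfolding has_second_derivative_def by (intro exI[of _ "\<lambda>t. 0"]) auto

text \<open>Made for the nonlinear diffusion terms. Existence is enough, since the differential
  equation supplies the value of their Laplacian.\<close>

lemma has_second_derivative_quadratic:
  assumes "has_second_derivative f D"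
  shows "\<exists>E. has_second_derivative (\<lambda>t. (d + a * f t) * f t) E"
proof -
  obtain f' where f': "\<forall>\<^sub>F t in nhds 0. (f has_real_derivative f' t) (at t)"
    and D: "(f' has_real_derivative D) (at 0)"
    using assms by (auto simp: has_second_derivative_def)
  have f0: "(f has_real_derivative f' 0) (at 0)"
    using f' by (rule eventually_nhds_x_imp_x)
  have "\<forall>\<^sub>F t in nhds 0. ((\<lambda>t. (d + a * f t) * f t) has_real_derivative (d + 2 * a * f t) * f' t) (at t)"
    using f' by eventually_elim (auto intro!: derivative_eq_intros simp: algebra_simps)
  moreover have "((\<lambda>t. (d + 2 * a * f t) * f' t) has_real_derivative
      (2 * a * f' 0) * f' 0 + (d + 2 * a * f 0) * D) (at 0)"
    using D f0 by (auto intro!: derivative_eq_intros)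
  ultimately show ?thesis
    unfolding has_second_derivative_def
    by (intro exI[of _ "(2 * a * f' 0) * f' 0 + (d + 2 * a * f 0) * D"]
        exI[of _ "\<lambda>t. (d + 2 * a * f t) * f' t"]) simp
qed

text \<open>At the minimum \<open>f' 0 = 0\<close>, so \<open>D < 0\<close> would make
  \<open>f'\<close> negative just to the right of 0, and the mean value theorem would give a value
  of \<open>f\<close> below \<open>f 0\<close>.\<close>

lemma has_second_derivative_local_min:
  assumes "has_second_derivative f D" and min: "\<forall>\<^sub>F t in nhds 0. f 0 \<le> f t"
  shows "D \<ge> 0"
proof (rule ccontr)
  assume "\<not> D \<ge> 0"
  obtain f' where f': "\<forall>\<^sub>F t in nhds 0. (f has_real_derivative f' t) (at t)"
    and D: "(f' has_real_derivative D) (at 0)"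
    using assms by (auto simp: has_second_derivative_def)
  obtain e where e: "e > 0"
    "\<And>t. \<bar>t\<bar> < e \<Longrightarrow> (f has_real_derivative f' t) (at t) \<and> f 0 \<le> f t"
    using eventually_conj[OF f' min] by (auto simp: eventually_nhds_metric dist_real_def)
  have "f' 0 = 0"
    by (rule DERIV_local_min[of f _ 0 e]) (use e in auto)
  obtain s where s: "s > 0" "\<And>h. 0 < h \<Longrightarrow> h < s \<Longrightarrow> f' h < 0"
    using has_real_derivative_neg_dec_right[OF D] \<open>\<not> D \<ge> 0\<close> \<open>f' 0 = 0\<close> by auto
  define b where "b = min e s / 2"
  have b: "0 < b" "b < e" "b < s" using e s by (auto simp: b_def)
  have "\<exists>z>0. z < b \<and> f b - f 0 = (b - 0) * f' z"
    by (rule MVT2) (use b e in auto)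
  then obtain z where z: "0 < z" "z < b" "f b - f 0 = b * f' z" by auto
  then have "f b - f 0 < 0"
    using s(2)[of z] b by (simp add: mult_pos_neg)
  then show False using e(2)[of b] b by simp
qed

definition has_pure_second_partials :: "('a::euclidean_space \<Rightarrow> real) \<Rightarrow> 'a \<Rightarrow> bool" where
  "has_pure_second_partials f x \<longleftrightarrow>
     (\<forall>i\<in>Basis. \<exists>D. has_second_derivative (\<lambda>t. f (x + t *\<^sub>R i)) D)"

lemma has_second_derivative_partial:
  assumes "has_pure_second_partials f x" "i \<in> Basis"
  shows "has_second_derivative (\<lambda>t. f (x + t *\<^sub>R i)) ((deriv ^^ 2) (\<lambda>t. f (x + t *\<^sub>R i)) 0)"
  using assms has_second_derivative_imp_deriv unfolding has_pure_second_partials_def by metis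

lemma has_pure_second_partials_diff_cmult:
  assumes "has_pure_second_partials f x" "has_pure_second_partials g x"
  shows "has_pure_second_partials (\<lambda>y. f y - c * g y) x"
  unfolding has_pure_second_partials_def
  using has_second_derivative_diff_cmult[OF has_second_derivative_partial has_second_derivative_partial]
    assms by blast

lemma laplacian_diff_cmult:
  assumes "has_pure_second_partials f x" "has_pure_second_partials g x"
  shows "laplacian (\<lambda>y. f y - c * g y) x = laplacian f x - c * laplacian g x"
proof -
  have "(deriv ^^ 2) (\<lambda>t. f (x + t *\<^sub>R i) - c * g (x + t *\<^sub>R i)) 0 =
      (deriv ^^ 2) (\<lambda>t. f (x + t *\<^sub>R i)) 0 - c * (deriv ^^ 2) (\<lambda>t. g (x + t *\<^sub>R i)) 0"
    if "i \<in> Basis" for i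
    by (intro has_second_derivative_imp_deriv has_second_derivative_diff_cmult
        has_second_derivative_partial assms that)
  then show ?thesis
    by (simp add: laplacian_def sum_subtractf sum_distrib_left)
qed

lemma has_pure_second_partials_const: "has_pure_second_partials (\<lambda>y. c) x"
  unfolding has_pure_second_partials_def using has_second_derivative_const by blast

lemma laplacian_const: "laplacian (\<lambda>y. c) x = 0"
  unfolding laplacian_def
  by (intro sum.neutral ballI has_second_derivative_imp_deriv has_second_derivative_const)

lemma has_pure_second_partials_quadratic:
  assumes "has_pure_second_partials f x"
  shows "has_pure_second_partials (\<lambda>y. (d + a * f y) * f y) x"
  using assms has_second_derivative_quadratic unfolding has_pure_second_partials_def by blast

text \<open>The restriction of \<open>f\<close> to each coordinate line through \<open>x\<close> has
  a local minimum there, so every summand of the Laplacian is nonnegative.\<close>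

lemma laplacian_nonneg_at_local_min:
  assumes f: "has_pure_second_partials f x" and min: "\<forall>\<^sub>F y in nhds x. f x \<le> f y"
  shows "laplacian f x \<ge> 0"
  unfolding laplacian_def
proof (intro sum_nonneg)
  fix i :: 'a assume i: "i \<in> Basis"
  have "((\<lambda>t. x + t *\<^sub>R i) \<longlongrightarrow> x + 0 *\<^sub>R i) (nhds (0::real))"
    by (intro tendsto_intros filterlim_ident)
  then have "\<forall>\<^sub>F t in nhds (0::real). f x \<le> f (x + t *\<^sub>R i)"
    using eventually_compose_filterlim[OF min] by simp
  then show "0 \<le> (deriv ^^ 2) (\<lambda>t. f (x + t *\<^sub>R i)) 0"
    using has_second_derivative_local_min[OF has_second_derivative_partial[OF f i]] by simp
qed

lemma GDERIV_along_line:
  assumes "GDERIV f (x + t *\<^sub>R e) :> d"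
  shows "((\<lambda>s. f (x + s *\<^sub>R e)) has_real_derivative e \<bullet> d) (at t)"
proof -
  have "((\<lambda>s. x + s *\<^sub>R e) has_derivative (\<lambda>s. s *\<^sub>R e)) (at t)"
    by (auto intro!: derivative_eq_intros)
  then have "((\<lambda>s. f (x + s *\<^sub>R e)) has_derivative (\<lambda>s. (s *\<^sub>R e) \<bullet> d)) (at t)"
    using assms unfolding gderiv_def by (rule has_derivative_compose)
  then show ?thesis
    unfolding has_field_derivative_def
    by (rule has_derivative_eq_rhs) (simp add: fun_eq_iff)
qed

lemma Ck_on_2_has_pure_second_partials:
  assumes "Ck_on 2 S f" "open S" "x \<in> S"
  shows "has_pure_second_partials f x"
  unfolding has_pure_second_partials_def
proof
  fix i :: 'a assume i: "i \<in> Basis"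
  obtain g where g: "\<And>y. y \<in> S \<Longrightarrow> GDERIV f y :> g y"
    and "\<forall>i\<in>Basis. Ck_on 1 S (\<lambda>y. g y \<bullet> i)"
    using assms(1) by (auto simp: numeral_2_eq_2)
  then obtain h where h: "\<And>y. y \<in> S \<Longrightarrow> GDERIV (\<lambda>y. g y \<bullet> i) y :> h y"
    using i by fastforce
  have "((\<lambda>t. x + t *\<^sub>R i) \<longlongrightarrow> x + 0 *\<^sub>R i) (nhds (0::real))"
    by (intro tendsto_intros filterlim_ident)
  then have "\<forall>\<^sub>F t in nhds (0::real). x + t *\<^sub>R i \<in> S"
    using assms by (auto intro: topological_tendstoD)
  then have "\<forall>\<^sub>F t in nhds 0. ((\<lambda>s. f (x + s *\<^sub>R i)) has_real_derivative g (x + t *\<^sub>R i) \<bullet> i) (at t)"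
    by eventually_elim (auto intro!: GDERIV_along_line g simp: inner_commute[of _ i])
  moreover have "((\<lambda>s. g (x + s *\<^sub>R i) \<bullet> i) has_real_derivative i \<bullet> h x) (at 0)"
    by (rule GDERIV_along_line) (use h assms in auto)
  ultimately show "\<exists>D. has_second_derivative (\<lambda>t. f (x + t *\<^sub>R i)) D"
    unfolding has_second_derivative_def by (intro exI[of _ "i \<bullet> h x"] exI[of _ "\<lambda>t. g (x + t *\<^sub>R i) \<bullet> i"]) simp
qed

section \<open>Hopf's boundary point lemma\<close>

text \<open>Hopf's classical exponential barrier: for \<alpha> > 0 it vanishes on the sphere of
  radius \<open>r\<close> about \<open>c\<close>, is positive inside, and decreases strictly in the
  radial direction.\<close>

definition hopf_barrier :: "real \<Rightarrow> 'a::euclidean_space \<Rightarrow> real \<Rightarrow> 'a \<Rightarrow> real" where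
  "hopf_barrier \<alpha> c r x = exp (- \<alpha> * (norm (x - c))\<^sup>2) - exp (- \<alpha> * r\<^sup>2)"

lemma hopf_barrier_has_second_derivative:
  assumes i: "i \<in> Basis"
  shows "has_second_derivative (\<lambda>t. hopf_barrier \<alpha> c r (x + t *\<^sub>R i))
     ((4 * \<alpha>\<^sup>2 * ((x - c) \<bullet> i)\<^sup>2 - 2 * \<alpha>) * exp (- \<alpha> * (norm (x - c))\<^sup>2))"
proof -
  define b where "b = (x - c) \<bullet> i"
  \<comment> \<open>\<open>q t\<close> is the squared distance from \<open>c\<close> to
    \<open>x + t *\<^sub>R i\<close>, a polynomial in \<open>t\<close> because \<open>i\<close> is a
    unit vector.\<close>
  define q where "q t = (norm (x - c))\<^sup>2 + 2 * t * b + t\<^sup>2" for t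
  have eq: "(norm (x + t *\<^sub>R i - c))\<^sup>2 = q t" for t
  proof -
    have "x + t *\<^sub>R i - c = (x - c) + t *\<^sub>R i" by simp
    also have "(norm \<dots>)\<^sup>2 = q t"
      using i unfolding q_def b_def power2_norm_eq_inner
      by (simp add: inner_add inner_commute power2_eq_square)
    finally show ?thesis .
  qed
  have "((\<lambda>t. exp (- \<alpha> * q t) - exp (- \<alpha> * r\<^sup>2)) has_real_derivative
      - \<alpha> * (2 * b + 2 * t) * exp (- \<alpha> * q t)) (at t)" for t
    unfolding q_def by (auto intro!: derivative_eq_intros simp: algebra_simps)
  moreover have "((\<lambda>t. - \<alpha> * (2 * b + 2 * t) * exp (- \<alpha> * q t)) has_real_derivative
      (4 * \<alpha>\<^sup>2 * b\<^sup>2 - 2 * \<alpha>) * exp (- \<alpha> * (norm (x - c))\<^sup>2)) (at 0)"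
    unfolding q_def
    by (auto intro!: derivative_eq_intros simp: algebra_simps power2_eq_square)
  ultimately show ?thesis
    unfolding has_second_derivative_def hopf_barrier_def eq b_def
    by (intro exI[of _ "\<lambda>t. - \<alpha> * (2 * b + 2 * t) * exp (- \<alpha> * q t)"]) (simp add: b_def)
qed

lemma hopf_barrier_has_pure_second_partials: "has_pure_second_partials (hopf_barrier \<alpha> c r) x"
  unfolding has_pure_second_partials_def using hopf_barrier_has_second_derivative by blast

lemma laplacian_hopf_barrier:
  fixes x :: "'a::euclidean_space"
  shows "laplacian (hopf_barrier \<alpha> c r) x =
    (4 * \<alpha>\<^sup>2 * (norm (x - c))\<^sup>2 - 2 * \<alpha> * real DIM('a)) * exp (- \<alpha> * (norm (x - c))\<^sup>2)"
proof -
  have n: "(norm (x - c))\<^sup>2 = (\<Sum>i\<in>Basis. ((x - c) \<bullet> i)\<^sup>2)"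
    unfolding power2_norm_eq_inner by (subst euclidean_inner) (simp add: power2_eq_square)
  have "laplacian (hopf_barrier \<alpha> c r) x =
    (\<Sum>i\<in>Basis. (4 * \<alpha>\<^sup>2 * ((x - c) \<bullet> i)\<^sup>2 - 2 * \<alpha>) * exp (- \<alpha> * (norm (x - c))\<^sup>2))"
    unfolding laplacian_def
    by (intro sum.cong refl has_second_derivative_imp_deriv hopf_barrier_has_second_derivative)
  also have "\<dots> = (4 * \<alpha>\<^sup>2 * (\<Sum>i\<in>Basis. ((x - c) \<bullet> i)\<^sup>2) - 2 * \<alpha> * real DIM('a)) *
      exp (- \<alpha> * (norm (x - c))\<^sup>2)"
    by (simp add: sum_distrib_right[symmetric] sum_subtractf sum_distrib_left)
  finally show ?thesis by (simp add: n)
qed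

text \<open>For large \<alpha> the term quadratic in \<alpha> beats both the dimension term and
  \<open>K\<close>, provided \<open>norm (x - c)\<close> is bounded away from 0. At the centre the
  Laplacian of the barrier is negative, hence the restriction to radii above
  \<open>r / 2\<close>.\<close>

lemma hopf_barrier_subsolution:
  fixes c :: "'a::euclidean_space"
  assumes "r > 0" "K \<ge> 0"
  obtains \<alpha> where "\<alpha> > 0" "\<And>x. norm (x - c) > r / 2 \<Longrightarrow>
    laplacian (hopf_barrier \<alpha> c r) x > K * hopf_barrier \<alpha> c r x"
proof -
  define N where "N = real DIM('a)"
  \<comment> \<open>The quotient makes \<open>\<alpha> * r\<^sup>2\<close> at least
    \<open>2 * N + K + 1\<close>, so that \<open>\<alpha> * (K + 1)\<close> remains once
    \<open>2 * \<alpha> * N\<close> is subtracted; the final \<open>+ 1\<close> gives \<alpha> \<ge>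
    1, so this remainder exceeds \<open>K\<close>.\<close>
  define \<alpha> where "\<alpha> = (2 * N + K + 1) / r\<^sup>2 + 1"
  have N: "N \<ge> 1" by (simp add: N_def Suc_leI)
  have \<alpha>: "\<alpha> \<ge> 1" using assms N by (simp add: \<alpha>_def)
  have \<alpha>r: "\<alpha> * r\<^sup>2 \<ge> 2 * N + K + 1" using assms by (simp add: \<alpha>_def field_simps)
  show ?thesis
  proof (rule that)
    show "\<alpha> > 0" using \<alpha> by simp
    fix x :: 'a assume x: "norm (x - c) > r / 2"
    define E where "E = exp (- \<alpha> * (norm (x - c))\<^sup>2)"
    have E: "E > 0" by (simp add: E_def)
    have "(r / 2)\<^sup>2 \<le> (norm (x - c))\<^sup>2" using x assms by (intro power_mono) auto
    then have "4 * \<alpha>\<^sup>2 * (norm (x - c))\<^sup>2 \<ge> 4 * \<alpha>\<^sup>2 * (r / 2)\<^sup>2"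
      by (intro mult_left_mono) auto
    also have "4 * \<alpha>\<^sup>2 * (r / 2)\<^sup>2 = \<alpha> * (\<alpha> * r\<^sup>2)" by (simp add: power2_eq_square)
    also have "\<dots> \<ge> \<alpha> * (2 * N + K + 1)" using \<alpha> \<alpha>r by (intro mult_left_mono) auto
    finally have "4 * \<alpha>\<^sup>2 * (norm (x - c))\<^sup>2 - 2 * \<alpha> * N \<ge> \<alpha> * (K + 1)"
      by (simp add: algebra_simps)
    moreover have "K < \<alpha> * (K + 1)"
      using mult_right_mono[OF \<alpha>, of "K + 1"] assms(2) by (simp only: mult_1) linarith
    ultimately have "4 * \<alpha>\<^sup>2 * (norm (x - c))\<^sup>2 - 2 * \<alpha> * N > K" by (rule less_le_trans[rotated])
    then have "laplacian (hopf_barrier \<alpha> c r) x > K * E"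
      using E unfolding laplacian_hopf_barrier E_def[symmetric] N_def by (intro mult_strict_right_mono)
    moreover have "K * hopf_barrier \<alpha> c r x \<le> K * E"
      using assms by (intro mult_left_mono) (auto simp: hopf_barrier_def E_def)
    ultimately show "laplacian (hopf_barrier \<alpha> c r) x > K * hopf_barrier \<alpha> c r x" by linarith
  qed
qed

text \<open>On an annulus next to the sphere, \<open>w\<close> stays above a positive multiple of
  the barrier, and both vanish at \<open>p\<close>. The barrier has a strictly negative outward
  slope at \<open>p\<close>, which forces one on \<open>w\<close> and contradicts the zero normal
  derivative.\<close>

lemma hopf_boundary_point:
  fixes c p :: "'a::euclidean_space"
  assumes r: "r > 0" and p: "p \<in> sphere c r" and K: "K \<ge> 0"
    and cont: "continuous_on (cball c r) w"
    and C2: "\<And>x. x \<in> ball c r \<Longrightarrow> has_pure_second_partials w x"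
    and pos: "\<And>x. x \<in> ball c r \<Longrightarrow> w x > 0"
    and nonneg: "\<And>x. x \<in> sphere c r \<Longrightarrow> w x \<ge> 0"
    and super: "\<And>x. x \<in> ball c r \<Longrightarrow> laplacian w x \<le> K * w x"
    and wp: "w p = 0"
    and normal: "has_normal_derivative w 0 p ((p - c) /\<^sub>R r)"
  shows False
proof -
  obtain \<alpha> where \<alpha>: "\<alpha> > 0" and sub: "\<And>x. norm (x - c) > r / 2 \<Longrightarrow>
    laplacian (hopf_barrier \<alpha> c r) x > K * hopf_barrier \<alpha> c r x"
    using hopf_barrier_subsolution[OF r K] by blast
  define h where "h = hopf_barrier \<alpha> c r"
  have "\<exists>x\<in>cball c (r / 2). \<forall>y\<in>cball c (r / 2). w x \<le> w y"
    using r by (intro continuous_attains_inf continuous_on_subset[OF cont]) auto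
  then obtain x0 where x0: "x0 \<in> cball c (r / 2)" "\<And>y. y \<in> cball c (r / 2) \<Longrightarrow> w x0 \<le> w y"
    by blast
  \<comment> \<open>Since \<open>h \<le> 1\<close>, this factor makes \<open>m * h \<le> w\<close>
    on the closed inner ball, in particular on the inner sphere of the annulus.\<close>
  define m where "m = w x0"
  have m: "m > 0" using pos x0 r by (simp add: m_def)
  have h_le: "h x \<le> 1" for x
  proof -
    have "exp (- \<alpha> * (norm (x - c))\<^sup>2) \<le> 1" using \<alpha> by simp
    then show ?thesis unfolding h_def hopf_barrier_def by (smt (verit) exp_gt_zero)
  qed
  define A where "A = cball c r - ball c (r / 2)"
  define \<psi> where "\<psi> x = w x - m * h x" for x
  have "compact A" unfolding A_def by (intro compact_diff) auto
  moreover have "p \<in> A" using p r by (auto simp: A_def)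
  moreover have "continuous_on A \<psi>"
    unfolding \<psi>_def h_def hopf_barrier_def
    by (intro continuous_intros continuous_on_subset[OF cont]) (auto simp: A_def)
  ultimately have "\<exists>y\<in>A. \<forall>z\<in>A. \<psi> y \<le> \<psi> z" by (intro continuous_attains_inf) auto
  then obtain y where y: "y \<in> A" "\<And>z. z \<in> A \<Longrightarrow> \<psi> y \<le> \<psi> z" by blast
  \<comment> \<open>A negative minimum of \<psi> lies on neither bounding sphere. In the open
    annulus it would give \<open>0 \<le> laplacian w y - m * laplacian h y < K * \<psi> y \<le>
    0\<close>.\<close>
  have \<psi>y: "\<psi> y \<ge> 0"
  proof (rule ccontr)
    assume neg: "\<not> \<psi> y \<ge> 0"
    have "y \<notin> sphere c r"
      using neg nonneg[of y] by (auto simp: \<psi>_def h_def hopf_barrier_def dist_norm norm_minus_commute)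
    moreover have "y \<notin> cball c (r / 2)"
    proof
      assume "y \<in> cball c (r / 2)"
      then have "w y \<ge> m" using x0 by (simp add: m_def)
      moreover have "m * h y \<le> m" using h_le[of y] m by simp
      ultimately show False using neg by (simp add: \<psi>_def)
    qed
    ultimately have yi: "y \<in> ball c r - cball c (r / 2)" using y(1) by (auto simp: A_def)
    then have "\<forall>\<^sub>F z in nhds y. z \<in> ball c r - cball c (r / 2)"
      by (intro eventually_nhds_in_open open_Diff) auto
    then have "\<forall>\<^sub>F z in nhds y. \<psi> y \<le> \<psi> z"
      by eventually_elim (auto intro!: y(2) simp: A_def)
    moreover have "has_pure_second_partials w y" using C2 yi by simp
    moreover have "has_pure_second_partials h y"
      unfolding h_def by (rule hopf_barrier_has_pure_second_partials)
    ultimately have "0 \<le> laplacian w y - m * laplacian h y"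
      using laplacian_nonneg_at_local_min[of \<psi> y] laplacian_diff_cmult[of w y h m]
        has_pure_second_partials_diff_cmult[of w y h m] by (simp add: \<psi>_def[abs_def])
    moreover have "laplacian w y \<le> K * w y" using super yi by simp
    moreover have "m * laplacian h y > m * (K * h y)"
      unfolding h_def using m sub yi
      by (intro mult_strict_left_mono sub) (auto simp: dist_norm norm_minus_commute)
    moreover have "K * w y - m * (K * h y) = K * \<psi> y" by (simp add: \<psi>_def algebra_simps)
    moreover have "K * \<psi> y \<le> 0" using K neg by (simp add: mult_nonneg_nonpos)
    ultimately show False by linarith
  qed
  define e where "e = (p - c) /\<^sub>R r"
  have pc: "norm (p - c) = r" using p by (simp add: dist_norm norm_minus_commute)
  have line: "norm (p + t *\<^sub>R e - c) = \<bar>r + t\<bar>" for t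
  proof -
    have "p + t *\<^sub>R e - c = ((r + t) / r) *\<^sub>R (p - c)"
      using r by (simp add: e_def algebra_simps add_divide_distrib divide_inverse)
    then have "norm (p + t *\<^sub>R e - c) = \<bar>r + t\<bar> / \<bar>r\<bar> * r" using pc by simp
    also have "\<dots> = \<bar>r + t\<bar>" using r by simp
    finally show ?thesis .
  qed
  have h_line: "h (p + t *\<^sub>R e) = exp (- \<alpha> * (r + t)\<^sup>2) - exp (- \<alpha> * r\<^sup>2)" for t
    unfolding h_def hopf_barrier_def line by simp
  have "((\<lambda>t. h (p + t *\<^sub>R e)) has_real_derivative - (2 * \<alpha> * r * exp (- \<alpha> * r\<^sup>2))) (at 0 within {..0})"
    unfolding h_line by (auto intro!: derivative_eq_intros)
  moreover have "((\<lambda>t. w (p + t *\<^sub>R e)) has_real_derivative 0) (at 0 within {..0})"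
    using normal by (simp add: has_normal_derivative_def e_def)
  ultimately have "((\<lambda>t. \<psi> (p + t *\<^sub>R e)) has_real_derivative
      0 - m * (- (2 * \<alpha> * r * exp (- \<alpha> * r\<^sup>2)))) (at 0 within {..0})"
    unfolding \<psi>_def by (intro DERIV_diff DERIV_cmult)
  \<comment> \<open>The left-sided slope of \<psi> at \<open>p\<close> along the outward radius is
    positive, so \<psi> falls below \<open>\<psi> p = 0\<close> just inside the sphere.\<close>
  moreover have "0 - m * (- (2 * \<alpha> * r * exp (- \<alpha> * r\<^sup>2))) > 0" using m \<alpha> r by simp
  ultimately obtain d where d: "d > 0"
    "\<And>s. 0 < s \<Longrightarrow> 0 - s \<in> {..0} \<Longrightarrow> s < d \<Longrightarrow> \<psi> (p + (0 - s) *\<^sub>R e) < \<psi> (p + 0 *\<^sub>R e)"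
    using has_real_derivative_pos_inc_left[of "\<lambda>t. \<psi> (p + t *\<^sub>R e)" _ 0 "{..0}"] by blast
  \<comment> \<open>\<open>s < d\<close> gives the decrease, and \<open>s < r / 2\<close> keeps the
    point in the annulus, where \<psi> is nonnegative.\<close>
  define s where "s = min d (r / 2) / 2"
  have s: "0 < s" "s < d" "s < r / 2" using d(1) r by (auto simp: s_def)
  have "\<psi> (p + (- s) *\<^sub>R e) < \<psi> p" using d(2)[of s] s by simp
  moreover have "\<psi> p = 0" using pc wp by (simp add: \<psi>_def h_def hopf_barrier_def)
  moreover have "p + (- s) *\<^sub>R e \<in> A"
    using line[of "- s"] s unfolding A_def by (auto simp: dist_norm norm_minus_commute)
  ultimately show False using y(2) \<psi>y by (smt (verit))
qed

section \<open>Maximum principles under the Neumann condition\<close>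

text \<open>The interior ball and the Neumann condition in one notion: the normal is replaced by the
  radius of the touching ball, the direction in which Hopf's lemma is stated.\<close>

definition neumann_touching_ball ::
    "'a::euclidean_space set \<Rightarrow> ('a \<Rightarrow> real) \<Rightarrow> 'a \<Rightarrow> bool" where
  "neumann_touching_ball \<Omega> w p \<longleftrightarrow>
     (\<exists>c r. r > 0 \<and> ball c r \<subseteq> \<Omega> \<and> p \<in> sphere c r \<and>
            has_normal_derivative w 0 p ((p - c) /\<^sub>R r))"

text \<open>At an interior minimum this is the second derivative test. If \<open>g p < 0\<close> at
  a boundary minimum, continuity gives \<open>g < 0\<close> on a small ball touching at
  \<open>p\<close>; there \<open>w > w p\<close>, and Hopf's lemma with \<open>K = 0\<close> applies
  to \<open>w - w p\<close>.\<close>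

lemma neumann_min_laplacian_nonneg:
  fixes w g :: "'a::euclidean_space \<Rightarrow> real"
  assumes \<Omega>: "open \<Omega>" and p: "p \<in> closure \<Omega>"
    and cont: "continuous_on (closure \<Omega>) w" "continuous_on (closure \<Omega>) g"
    and min: "\<And>x. x \<in> closure \<Omega> \<Longrightarrow> w p \<le> w x"
    and C2: "\<And>x. x \<in> \<Omega> \<Longrightarrow> has_pure_second_partials w x"
    and lap: "\<And>x. x \<in> \<Omega> \<Longrightarrow> laplacian w x = g x"
    and bd: "p \<in> frontier \<Omega> \<Longrightarrow> neumann_touching_ball \<Omega> w p"
  shows "g p \<ge> 0"
proof (rule ccontr)
  assume gp: "\<not> g p \<ge> 0"
  \<comment> \<open>Used twice: to exclude \<open>p \<in> \<Omega>\<close>, and to see that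
    \<open>w\<close> exceeds \<open>w p\<close> strictly wherever \<open>g < 0\<close> inside
    \<Omega>.\<close>
  have interior: "g x \<ge> 0" if x: "x \<in> \<Omega>" "w x = w p" for x
  proof -
    have "\<forall>\<^sub>F y in nhds x. y \<in> \<Omega>" using \<Omega> x by (intro eventually_nhds_in_open)
    then have "\<forall>\<^sub>F y in nhds x. w x \<le> w y"
      by eventually_elim (use x min closure_subset in auto)
    then show ?thesis
      using laplacian_nonneg_at_local_min[OF C2[OF x(1)]] lap[OF x(1)] by simp
  qed
  have "p \<notin> \<Omega>" using interior gp by auto
  then have "p \<in> frontier \<Omega>" using p \<Omega> by (simp add: frontier_def interior_open)
  then obtain c r where r: "r > 0" and sub: "ball c r \<subseteq> \<Omega>" and pc: "p \<in> sphere c r"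
    and normal: "has_normal_derivative w 0 p ((p - c) /\<^sub>R r)"
    using bd unfolding neumann_touching_ball_def by blast
  have "- g p > 0" using gp by simp
  then obtain \<delta> where \<delta>: "\<delta> > 0" "\<And>x. x \<in> closure \<Omega> \<Longrightarrow> dist x p < \<delta> \<Longrightarrow> \<bar>g x - g p\<bar> < - g p"
    using cont(2) p unfolding continuous_on_iff dist_real_def by blast
  define s where "s = min r (\<delta> / 2)"
  have s: "s > 0" "s \<le> r" "2 * s \<le> \<delta>" using r \<delta> by (auto simp: s_def)
  \<comment> \<open>Moving the centre along the radius to distance \<open>s\<close> from
    \<open>p\<close> gives a smaller ball, internally tangent at \<open>p\<close> with the same
    outward direction. As \<open>2 * s \<le> \<delta>\<close>, all of it lies in the region where
    \<open>g < 0\<close>.\<close>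
  define c' where "c' = p - (s / r) *\<^sub>R (p - c)"
  have norm_pc: "norm (p - c) = r" using pc by (simp add: dist_norm norm_minus_commute)
  have "p - c' = (s / r) *\<^sub>R (p - c)" by (simp add: c'_def)
  then have pc': "dist c' p = s" and e: "(p - c') /\<^sub>R s = (p - c) /\<^sub>R r"
    using norm_pc r s by (auto simp: dist_norm norm_minus_commute[of c'] divide_inverse)
  have "c' - c = (1 - s / r) *\<^sub>R (p - c)" by (simp add: c'_def algebra_simps)
  then have "norm (c' - c) = \<bar>1 - s / r\<bar> * r" using norm_pc by simp
  also have "\<dots> = r - s" using r s by (simp add: field_simps)
  finally have "ball c' s \<subseteq> ball c r"
    by (simp add: ball_subset_ball_iff dist_norm)
  then have sub': "ball c' s \<subseteq> \<Omega>" using sub by blast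
  then have csub: "cball c' s \<subseteq> closure \<Omega>"
    using closure_mono[OF sub'] s by simp
  have neg: "g x < 0" if x: "x \<in> ball c' s" for x
  proof -
    have "dist x p < \<delta>" using x pc' s dist_triangle[of x p c'] by (simp add: dist_commute)
    then show ?thesis using \<delta>(2)[of x] x csub by force
  qed
  have lap': "laplacian (\<lambda>y. w y - 1 * w p) x = g x" if "x \<in> ball c' s" for x
    using laplacian_diff_cmult[OF C2 has_pure_second_partials_const, of x 1 "w p"]
      lap that sub' by (auto simp: laplacian_const)
  show False
  proof (rule hopf_boundary_point[of s p c' 0 "\<lambda>y. w y - 1 * w p"])
    show "continuous_on (cball c' s) (\<lambda>y. w y - 1 * w p)"
      by (intro continuous_intros continuous_on_subset[OF cont(1) csub])
    show "has_pure_second_partials (\<lambda>y. w y - 1 * w p) x" if "x \<in> ball c' s" for x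
      by (intro has_pure_second_partials_diff_cmult has_pure_second_partials_const C2)
         (use that sub' in blast)
    show "0 < w x - 1 * w p" if x: "x \<in> ball c' s" for x
      using neg[OF x] interior[of x] min[of x] x sub' csub by force
    show "0 \<le> w x - 1 * w p" if "x \<in> sphere c' s" for x
      using min[of x] that csub by force
    show "has_normal_derivative (\<lambda>y. w y - 1 * w p) 0 p ((p - c') /\<^sub>R s)"
      using normal unfolding e has_normal_derivative_def by (auto intro!: derivative_eq_intros)
    show "laplacian (\<lambda>y. w y - 1 * w p) x \<le> 0 * (w x - 1 * w p)" if "x \<in> ball c' s" for x
      using lap'[OF that] neg[OF that] by simp
  qed (use s pc' in auto)
qed

text \<open>The zero set in \<Omega> is relatively closed. Were it not open, a zero-free ball in
  \<Omega> would touch it at an interior point, where the derivative vanishes because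
  \<open>w\<close> is minimal, against Hopf's lemma. By connectedness there are no interior zeros,
  and Hopf's lemma at the boundary excludes the rest.\<close>

lemma strong_maximum_principle_neumann:
  fixes w :: "'a::euclidean_space \<Rightarrow> real"
  assumes \<Omega>: "open \<Omega>" "connected \<Omega>" and K: "K \<ge> 0"
    and cont: "continuous_on (closure \<Omega>) w"
    and nonneg: "\<And>x. x \<in> closure \<Omega> \<Longrightarrow> w x \<ge> 0"
    and C2: "\<And>x. x \<in> \<Omega> \<Longrightarrow> has_pure_second_partials w x"
    and diff: "\<And>x. x \<in> \<Omega> \<Longrightarrow> \<exists>d. GDERIV w x :> d"
    and super: "\<And>x. x \<in> \<Omega> \<Longrightarrow> laplacian w x \<le> K * w x"
    and bd: "\<And>p. p \<in> frontier \<Omega> \<Longrightarrow> neumann_touching_ball \<Omega> w p"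
    and nontriv: "x0 \<in> \<Omega>" "w x0 \<noteq> 0"
    and p: "p \<in> closure \<Omega>"
  shows "w p > 0"
proof -
  have hopf: False if r: "r > 0" "ball c r \<subseteq> \<Omega>" "q \<in> sphere c r" "w q = 0"
      "has_normal_derivative w 0 q ((q - c) /\<^sub>R r)" and pos: "\<And>x. x \<in> ball c r \<Longrightarrow> w x > 0" for c q r
  proof (rule hopf_boundary_point[OF r(1) r(3) K _ _ pos _ _ r(4,5)])
    have "cball c r \<subseteq> closure \<Omega>" using closure_mono[OF r(2)] r(1) by simp
    then show "continuous_on (cball c r) w" "\<And>x. x \<in> sphere c r \<Longrightarrow> w x \<ge> 0"
      using continuous_on_subset[OF cont] nonneg by auto
  qed (use C2 super r in auto)
  define Z where "Z = {x \<in> \<Omega>. w x = 0}"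
  have cont\<Omega>: "continuous_on \<Omega> w" using continuous_on_subset[OF cont closure_subset] .
  have "closedin (top_of_set \<Omega>) Z"
    unfolding Z_def by (rule continuous_closedin_preimage_constant[OF cont\<Omega>])
  moreover have "open Z"
  proof (rule ccontr)
    assume "\<not> open Z"
    then obtain z where z: "z \<in> Z" "\<And>e. e > 0 \<Longrightarrow> \<not> ball z e \<subseteq> Z"
      unfolding open_contains_ball by blast
    obtain e where e: "e > 0" "ball z e \<subseteq> \<Omega>"
      using \<Omega>(1) z(1) unfolding Z_def by (auto simp: open_contains_ball)
    \<comment> \<open>A nonzero \<open>y\<close> within \<open>e / 2\<close> of \<open>z\<close> is
      nearer to \<open>z\<close> than to the complement of \<open>ball z e\<close>, so the closed
      ball about \<open>y\<close> through \<open>z\<close> stays in \<Omega>.\<close>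
    have "\<not> ball z (e / 2) \<subseteq> Z" using z(2) e by simp
    then obtain y where y: "y \<in> ball z (e / 2)" "y \<notin> Z" by blast
    have "cball y (dist y z) \<subseteq> ball z e"
    proof
      fix x assume "x \<in> cball y (dist y z)"
      then show "x \<in> ball z e"
        using y(1) dist_triangle[of z x y] by (simp add: dist_commute)
    qed
    then have sub: "cball y (dist y z) \<subseteq> \<Omega>" using e by blast
    define Z' where "Z' = {x \<in> cball y (dist y z). w x = 0}"
    have "closed Z'"
      unfolding Z'_def
      by (intro continuous_closed_preimage_constant continuous_on_subset[OF cont\<Omega> sub] closed_cball)
    moreover have "bounded Z'"
      unfolding Z'_def by (rule bounded_subset[OF bounded_cball]) auto
    ultimately have "compact Z'" by (simp add: compact_eq_bounded_closed)
    moreover have "z \<in> Z'" using z(1) by (auto simp: Z'_def Z_def)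
    ultimately have "\<exists>q\<in>Z'. \<forall>x\<in>Z'. dist y q \<le> dist y x"
      \<comment> \<open>A zero \<open>q\<close> nearest to \<open>y\<close> makes the open ball
        about \<open>y\<close> through \<open>q\<close> free of zeros.\<close>
      by (intro continuous_attains_inf continuous_intros) auto
    then obtain q where q: "q \<in> Z'" "\<And>x. x \<in> Z' \<Longrightarrow> dist y q \<le> dist y x" by blast
    have q\<Omega>: "q \<in> \<Omega>" "w q = 0" using q(1) sub by (auto simp: Z'_def)
    have "y \<in> \<Omega>" using y(1) e by auto
    then have "y \<noteq> q" using y(2) q\<Omega> by (auto simp: Z_def)
    have bsub: "ball y (dist y q) \<subseteq> cball y (dist y z)"
      using q(1) by (auto simp: Z'_def)
    have pos: "w x > 0" if x: "x \<in> ball y (dist y q)" for x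
    proof -
      have "x \<in> \<Omega>" using x bsub sub by blast
      then have "w x \<ge> 0" using nonneg closure_subset by blast
      moreover have "w x \<noteq> 0" using q(2)[of x] x bsub by (auto simp: Z'_def)
      ultimately show ?thesis by simp
    qed
    \<comment> \<open>\<open>q\<close> is an interior minimum, as \<open>w q = 0 \<le> w\<close>, so
      the derivative of \<open>w\<close> at \<open>q\<close> along any line is zero.\<close>
    have "has_normal_derivative w 0 q ((q - y) /\<^sub>R dist y q)"
    proof -
      define n where "n = (q - y) /\<^sub>R dist y q"
      obtain d where "GDERIV w q :> d" using diff q\<Omega> by blast
      then have D: "((\<lambda>t. w (q + t *\<^sub>R n)) has_real_derivative n \<bullet> d) (at 0)"
        by (intro GDERIV_along_line) simp
      have "((\<lambda>t. q + t *\<^sub>R n) \<longlongrightarrow> q + 0 *\<^sub>R n) (nhds (0::real))"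
        by (intro tendsto_intros filterlim_ident)
      then have "\<forall>\<^sub>F t in nhds (0::real). q + t *\<^sub>R n \<in> \<Omega>"
        using \<Omega>(1) q\<Omega> by (auto intro: topological_tendstoD)
      then obtain b where b: "b > 0" "\<And>t. \<bar>t\<bar> < b \<Longrightarrow> q + t *\<^sub>R n \<in> \<Omega>"
        by (auto simp: eventually_nhds_metric dist_real_def)
      have "n \<bullet> d = 0"
        by (rule DERIV_local_min[OF D b(1)]) (use b(2) nonneg closure_subset q\<Omega> in auto)
      then show ?thesis
        using has_field_derivative_at_within[OF D, of "{..0}"]
        unfolding has_normal_derivative_def n_def[symmetric] by simp
    qed
    then show False
      using hopf[of "dist y q" y q] pos q\<Omega> \<open>y \<noteq> q\<close> bsub sub by auto
  qed
  then have "openin (top_of_set \<Omega>) Z"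
    by (simp add: openin_open_eq \<Omega>(1) Z_def)
  ultimately have "Z = {} \<or> Z = \<Omega>" using \<Omega>(2) unfolding connected_clopen by blast
  then have "Z = {}" using nontriv by (auto simp: Z_def)
  then have interior: "w x > 0" if "x \<in> \<Omega>" for x
    using that nonneg[of x] closure_subset[of \<Omega>] by (force simp: Z_def)
  show ?thesis
  proof (cases "p \<in> \<Omega>")
    case False
    then have "p \<in> frontier \<Omega>" using p \<Omega> by (simp add: frontier_def interior_open)
    then obtain c r where "r > 0" "ball c r \<subseteq> \<Omega>" "p \<in> sphere c r"
      "has_normal_derivative w 0 p ((p - c) /\<^sub>R r)"
      using bd unfolding neumann_touching_ball_def by blast
    then have "w p \<noteq> 0" using hopf[of r c p] interior by blast
    then show ?thesis using nonneg[OF p] by simp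
  qed (rule interior)
qed

section \<open>The outward normal at a touching ball\<close>

text \<open>Directions \<open>d\<close> with \<open>d \<bullet> (p - c) < 0\<close> enter the ball,
  where the defining function is negative, so \<open>d \<bullet> g \<le> 0\<close>. One half-space
  thus lies in the other, which makes \<open>g\<close> a positive multiple of
  \<open>p - c\<close>.\<close>

lemma outward_unit_normal_touching_ball:
  fixes p c :: "'a::euclidean_space"
  assumes n: "outward_unit_normal \<Omega> p n" and p: "p \<in> frontier \<Omega>"
    and r: "r > 0" and ball: "ball c r \<subseteq> \<Omega>" and pc: "p \<in> sphere c r"
  shows "n = (p - c) /\<^sub>R r"
proof -
  obtain U \<phi> g where U: "p \<in> U" "open U" and g: "GDERIV \<phi> p :> g" and ng: "n = sgn g"
    and inside: "\<Omega> \<inter> U = {x \<in> U. \<phi> x < 0}"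
    and zero: "frontier \<Omega> \<inter> U = {x \<in> U. \<phi> x = 0}"
    and nz: "\<forall>x\<in>U. \<phi> x = 0 \<longrightarrow> \<not> (GDERIV \<phi> x :> 0)"
    using n unfolding outward_unit_normal_def local_defining_function_def by blast
  have \<phi>p: "\<phi> p = 0" using zero p U by blast
  then have "g \<noteq> 0" using nz U g by blast
  have norm_pc: "norm (p - c) = r" using pc by (simp add: dist_norm norm_minus_commute)
  have inward: "d \<bullet> g \<le> 0" if d: "d \<bullet> (p - c) < 0" for d
  proof (rule ccontr)
    assume "\<not> d \<bullet> g \<le> 0"
    have "((\<lambda>t. \<phi> (p + t *\<^sub>R d)) has_real_derivative d \<bullet> g) (at 0)"
      by (rule GDERIV_along_line) (use g in simp)
    then obtain b where b: "b > 0" "\<And>t. 0 < t \<Longrightarrow> t < b \<Longrightarrow> \<phi> (p + t *\<^sub>R d) > 0"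
      using DERIV_pos_inc_right[of "\<lambda>t. \<phi> (p + t *\<^sub>R d)" "d \<bullet> g" 0] \<open>\<not> d \<bullet> g \<le> 0\<close> \<phi>p by auto
    have "((\<lambda>t. p + t *\<^sub>R d) \<longlongrightarrow> p + 0 *\<^sub>R d) (nhds (0::real))"
      by (intro tendsto_intros filterlim_ident)
    then have "\<forall>\<^sub>F t in nhds (0::real). p + t *\<^sub>R d \<in> U"
      using U by (auto intro: topological_tendstoD)
    then obtain b' where b': "b' > 0" "\<And>t. \<bar>t\<bar> < b' \<Longrightarrow> p + t *\<^sub>R d \<in> U"
      by (auto simp: eventually_nhds_metric dist_real_def)
    have "d \<noteq> 0" using d by auto
    \<comment> \<open>Half the positive root of
      \<open>t * (t * (d \<bullet> d) + 2 * (d \<bullet> (p - c)))\<close>, the change of the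
      squared distance to \<open>c\<close>; below it the point is strictly inside the ball.\<close>
    then have "- (d \<bullet> (p - c)) / (d \<bullet> d) > 0" using d by (intro divide_pos_pos) auto
    then obtain t where "0 < t" "t < min (min b b') (- (d \<bullet> (p - c)) / (d \<bullet> d))"
      using b(1) b'(1) dense[of 0 "min (min b b') (- (d \<bullet> (p - c)) / (d \<bullet> d))"] by auto
    then have t: "0 < t" "t < b" "t < b'" "t < - (d \<bullet> (p - c)) / (d \<bullet> d)"
      by auto
    have "t * (d \<bullet> d) < - (d \<bullet> (p - c))" using t(4) \<open>d \<noteq> 0\<close> by (simp add: field_simps)
    then have "t * (t * (d \<bullet> d) + 2 * (d \<bullet> (p - c))) < 0"
      using t(1) d by (intro mult_pos_neg) auto
    moreover have "(norm (p + t *\<^sub>R d - c))\<^sup>2 = r\<^sup>2 + t * (t * (d \<bullet> d) + 2 * (d \<bullet> (p - c)))"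
    proof -
      have "p + t *\<^sub>R d - c = (p - c) + t *\<^sub>R d" by simp
      also have "(norm \<dots>)\<^sup>2 = (norm (p - c))\<^sup>2 + t * (t * (d \<bullet> d) + 2 * (d \<bullet> (p - c)))"
      proof -
        have "(x + t *\<^sub>R d) \<bullet> (x + t *\<^sub>R d) = x \<bullet> x + t * (t * (d \<bullet> d) + 2 * (d \<bullet> x))" for x
          by (simp add: inner_add_left inner_add_right inner_commute[of x d] algebra_simps)
        then show ?thesis unfolding power2_norm_eq_inner .
      qed
      finally show ?thesis using norm_pc by simp
    qed
    ultimately have "(norm (p + t *\<^sub>R d - c))\<^sup>2 < r\<^sup>2" by linarith
    then have "norm (p + t *\<^sub>R d - c) < r"
      using r by (rule power2_less_imp_less[OF _ less_imp_le])
    then have "p + t *\<^sub>R d \<in> ball c r"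
      unfolding mem_ball dist_norm norm_minus_commute[of c "p + t *\<^sub>R d"] .
    then have "p + t *\<^sub>R d \<in> \<Omega> \<inter> U"
      using ball b'(2)[of t] t by auto
    then have "\<phi> (p + t *\<^sub>R d) < 0" using inside by blast
    then show False using b(2)[of t] t by simp
  qed
  define e where "e = (p - c) /\<^sub>R r"
  have e: "norm e = 1" using norm_pc r by (simp add: e_def)
  have pce: "p - c = r *\<^sub>R e" using r by (simp add: e_def)
  define k where "k = g \<bullet> e"
  define h where "h = g - k *\<^sub>R e"
  have ee: "e \<bullet> e = 1" using e by (simp add: norm_eq_1)
  have he: "h \<bullet> e = 0" by (simp add: h_def k_def inner_diff_left ee)
  have hg: "h \<bullet> g = h \<bullet> h"
  proof -
    have "h \<bullet> g = h \<bullet> (h + k *\<^sub>R e)" by (simp add: h_def)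
    then show ?thesis using he by (simp add: inner_add_right)
  qed
  have k: "k \<ge> 0"
    using inward[of "- e"] r by (simp add: pce ee k_def inner_commute)
  \<comment> \<open>Test the component \<open>h\<close> of \<open>g\<close> orthogonal to \<open>e\<close>, tilted slightly into the ball.\<close>
  have small: "h \<bullet> h \<le> \<eta> * k" if "\<eta> > 0" for \<eta>
  proof -
    have "(h - \<eta> *\<^sub>R e) \<bullet> (p - c) < 0" using that r by (simp add: pce inner_diff_left he ee)
    then have "(h - \<eta> *\<^sub>R e) \<bullet> g \<le> 0" by (rule inward)
    then show ?thesis using hg unfolding k_def inner_commute[of g e] by (simp add: inner_diff_left)
  qed
  have "h \<bullet> h \<le> 0"
  proof (cases "k = 0")
    case False
    show ?thesis
    proof (rule ccontr)
      assume "\<not> h \<bullet> h \<le> 0"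
      \<comment> \<open>With this tilt \<open>small\<close> would give that
        \<open>h \<bullet> h\<close> is at most half of itself.\<close>
      then have "h \<bullet> h / (2 * k) > 0" using k False by (intro divide_pos_pos) auto
      then have "h \<bullet> h \<le> (h \<bullet> h / (2 * k)) * k" by (rule small)
      then show False using False \<open>\<not> h \<bullet> h \<le> 0\<close> by simp
    qed
  qed (use small[of 1] in simp)
  then have "h = 0" using inner_ge_zero[of h] by (metis inner_eq_zero_iff order_antisym)
  then have "g = k *\<^sub>R e" by (simp add: h_def)
  moreover from this have "k > 0" using k \<open>g \<noteq> 0\<close> by (cases "k = 0") auto
  moreover have "sgn e = e" using e by (simp add: sgn_div_norm)
  ultimately have "n = e" using ng by (simp add: sgn_scaleR)
  then show ?thesis by (simp add: e_def)
qed

section \<open>The competition system\<close>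

lemma has_normal_derivative_quadratic:
  assumes "has_normal_derivative f 0 x n"
  shows "has_normal_derivative (\<lambda>y. (d + a * f y) * f y) 0 x n"
  using assms unfolding has_normal_derivative_def by (auto intro!: derivative_eq_intros)

lemma GDERIV_quadratic:
  assumes "GDERIV f x :> D"
  shows "\<exists>E. GDERIV (\<lambda>y. (d + a * f y) * f y) x :> E"
proof -
  have "GDERIV (\<lambda>y. (d + a * f y)) x :> 0 + (a *\<^sub>R D + f x *\<^sub>R 0)"
    by (intro GDERIV_add GDERIV_mult GDERIV_const assms)
  then show ?thesis using GDERIV_mult[OF _ assms] by blast
qed

text \<open>The system is symmetric under exchanging the two species, which reduces case (ii) to
  case (i).\<close>

lemma nonneg_classical_solution_swap:
  assumes "nonneg_classical_solution \<Omega> \<nu> d1 d2 a11 a22 a1 a2 u v"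
  shows "nonneg_classical_solution \<Omega> \<nu> d2 d1 a22 a11 a2 a1 v u"
proof -
  have eq: "1 - v x - a2 * u x = 1 - a2 * u x - v x" "1 - a1 * v x - u x = 1 - u x - a1 * v x" for x
    by simp_all
  show ?thesis using assms unfolding nonneg_classical_solution_def eq by blast
qed

lemma no_coexistence:
  fixes \<Omega> :: "'a::euclidean_space set"
  assumes dom: "smooth_bounded_domain \<Omega>"
    and \<nu>: "\<forall>x\<in>frontier \<Omega>. outward_unit_normal \<Omega> x (\<nu> x)"
    and d: "d1 > 0" "d2 > 0" and a: "a11 \<ge> 0" "a22 \<ge> 0" and a2: "0 < a2" "a2 < 1" and a1: "a1 > 1"
    and sol: "nonneg_classical_solution \<Omega> \<nu> d1 d2 a11 a22 a1 a2 u v"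
  shows "(\<forall>x\<in>\<Omega>. u x = 0) \<or> (\<forall>x\<in>\<Omega>. v x = 0)"
proof (rule ccontr)
  assume "\<not> ?thesis"
  then obtain xu xv where xu: "xu \<in> \<Omega>" "u xu \<noteq> 0" and xv: "xv \<in> \<Omega>" "v xv \<noteq> 0" by blast
  have \<Omega>: "open \<Omega>" "connected \<Omega>" "\<Omega> \<noteq> {}" "bounded \<Omega>"
    and ibc: "\<And>p. p \<in> frontier \<Omega> \<Longrightarrow> interior_ball_condition \<Omega> p"
    using dom by (auto simp: smooth_bounded_domain_def)
  have touch: "neumann_touching_ball \<Omega> f p"
    if p: "p \<in> frontier \<Omega>" "has_normal_derivative f 0 p (\<nu> p)" for f p
  proof -
    obtain c r where cr: "r > 0" "ball c r \<subseteq> \<Omega>" "p \<in> sphere c r"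
      using ibc[OF p(1)] unfolding interior_ball_condition_def by blast
    then have "\<nu> p = (p - c) /\<^sub>R r"
      using outward_unit_normal_touching_ball \<nu> p(1) by blast
    then show ?thesis using cr p(2) unfolding neumann_touching_ball_def by metis
  qed
  have cl: "compact (closure \<Omega>)" "closure \<Omega> \<noteq> {}" using \<Omega> by (auto simp: compact_closure)
  have cont: "continuous_on (closure \<Omega>) u" "continuous_on (closure \<Omega>) v"
    and diff: "\<And>x. x \<in> \<Omega> \<Longrightarrow> \<exists>D. GDERIV v x :> D"
    and C2: "Ck_on 2 \<Omega> u" "Ck_on 2 \<Omega> v"
    and nn: "\<And>x. x \<in> closure \<Omega> \<Longrightarrow> u x \<ge> 0" "\<And>x. x \<in> closure \<Omega> \<Longrightarrow> v x \<ge> 0"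
    and nd: "\<And>x. x \<in> frontier \<Omega> \<Longrightarrow> has_normal_derivative u 0 x (\<nu> x)"
      "\<And>x. x \<in> frontier \<Omega> \<Longrightarrow> has_normal_derivative v 0 x (\<nu> x)"
    using sol unfolding nonneg_classical_solution_def C1_closure_def by blast+
  \<comment> \<open>The equations prescribe the Laplacians of \<open>P\<close> and \<open>Q\<close>,
    so the maximum principles are applied to these. As both are increasing in the nonnegative
    densities, their extrema are attained where those of \<open>u\<close> and \<open>v\<close>
    are.\<close>
  define P where "P y = (d1 + a11 * u y) * u y" for y
  define Q where "Q y = (d2 + a22 * v y) * v y" for y
  have lapP: "laplacian P x = - (u x * (1 - u x - a1 * v x))"
    and lapQ: "laplacian Q x = - (v x * (1 - a2 * u x - v x))" if "x \<in> \<Omega>" for x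
    using sol that unfolding nonneg_classical_solution_def P_def[abs_def] Q_def[abs_def]
    by (auto simp: eq_neg_iff_add_eq_0)
  have C2P: "has_pure_second_partials P x" and C2Q: "has_pure_second_partials Q x"
    if "x \<in> \<Omega>" for x
    unfolding P_def[abs_def] Q_def[abs_def]
    using Ck_on_2_has_pure_second_partials C2 \<Omega>(1) that
    by (blast intro: has_pure_second_partials_quadratic)+
  have contP: "continuous_on (closure \<Omega>) P" and contQ: "continuous_on (closure \<Omega>) Q"
    unfolding P_def[abs_def] Q_def[abs_def] by (intro continuous_intros cont)+
  have ndP: "has_normal_derivative P 0 x (\<nu> x)" and ndQ: "has_normal_derivative Q 0 x (\<nu> x)"
    if "x \<in> frontier \<Omega>" for x
    unfolding P_def[abs_def] Q_def[abs_def] using nd that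
    by (blast intro: has_normal_derivative_quadratic)+
  obtain x0 where x0: "x0 \<in> closure \<Omega>" "\<And>x. x \<in> closure \<Omega> \<Longrightarrow> u x \<le> u x0"
    using continuous_attains_sup[OF cl cont(1)] by blast
  obtain x1 where x1: "x1 \<in> closure \<Omega>" "\<And>x. x \<in> closure \<Omega> \<Longrightarrow> v x1 \<le> v x"
    using continuous_attains_inf[OF cl cont(2)] by blast
  obtain x2 where x2: "x2 \<in> closure \<Omega>" "\<And>x. x \<in> closure \<Omega> \<Longrightarrow> v x \<le> v x2"
    using continuous_attains_sup[OF cl cont(2)] by blast
  have "xu \<in> closure \<Omega>" using xu closure_subset by blast
  then have u0: "u x0 > 0" using xu(2) nn(1)[of xu] x0(2)[of xu] by linarith
  have max_u: "u x0 + a1 * v x0 \<le> 1"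
  proof -
    \<comment> \<open>The minimum principle is applied to \<open>- P\<close>, written
      \<open>0 - 1 * P\<close> to fit the rules for \<open>f - c * g\<close>.\<close>
    have "0 \<le> u x0 * (1 - u x0 - a1 * v x0)"
    proof (rule neumann_min_laplacian_nonneg[OF \<Omega>(1) x0(1)])
      show "continuous_on (closure \<Omega>) (\<lambda>x. 0 - 1 * P x)"
        "continuous_on (closure \<Omega>) (\<lambda>x. u x * (1 - u x - a1 * v x))"
        by (intro continuous_intros cont contP)+
      show "0 - 1 * P x0 \<le> 0 - 1 * P x" if "x \<in> closure \<Omega>" for x
      proof -
        have "P x \<le> P x0"
          unfolding P_def using x0(2)[OF that] nn(1)[OF that] d a
          by (intro mult_mono add_mono) auto
        then show ?thesis by simp
      qed
      show "has_pure_second_partials (\<lambda>x. 0 - 1 * P x) x" if "x \<in> \<Omega>" for x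
        by (intro has_pure_second_partials_diff_cmult has_pure_second_partials_const C2P that)
      show "laplacian (\<lambda>x. 0 - 1 * P x) x = u x * (1 - u x - a1 * v x)" if "x \<in> \<Omega>" for x
        using laplacian_diff_cmult[OF has_pure_second_partials_const C2P[OF that], of 0 1]
          lapP[OF that] by (simp add: laplacian_const)
      show "neumann_touching_ball \<Omega> (\<lambda>x. 0 - 1 * P x) x0" if "x0 \<in> frontier \<Omega>"
        using ndP[OF that] that
        by (intro touch) (auto simp: has_normal_derivative_def intro!: derivative_eq_intros)
    qed
    then show ?thesis using u0 by (simp add: zero_le_mult_iff)
  qed
  \<comment> \<open>Chosen so that
    \<open>a2 * u + v - 1 \<le> K * d2 \<le> K * (d2 + a22 * v)\<close>; multiplying by
    \<open>v\<close> gives \<open>laplacian Q \<le> K * Q\<close>. The maximum \<open>v x2\<close>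
    serves only this bound.\<close>
  define K where "K = (a2 * u x0 + v x2) / d2"
  have K: "K \<ge> 0" using nn x0 x2 d a2 by (simp add: K_def)
  have "Q x1 > 0"
  proof (rule strong_maximum_principle_neumann[OF \<Omega>(1,2) K contQ _ C2Q _ _ _ xv(1) _ x1(1)])
    show "Q x \<ge> 0" if "x \<in> closure \<Omega>" for x
      unfolding Q_def using nn(2)[OF that] d a by simp
    show "\<exists>D. GDERIV Q x :> D" if "x \<in> \<Omega>" for x
      unfolding Q_def[abs_def] using diff[OF that] GDERIV_quadratic by blast
    show "laplacian Q x \<le> K * Q x" if x: "x \<in> \<Omega>" for x
    proof -
      have x': "x \<in> closure \<Omega>" using x closure_subset by blast
      have "a2 * u x + v x - 1 \<le> K * d2"
      proof -
        have "a2 * u x \<le> a2 * u x0" using x0(2)[OF x'] a2 by simp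
        moreover have "K * d2 = a2 * u x0 + v x2" using d by (simp add: K_def)
        ultimately show ?thesis using x2(2)[OF x'] by linarith
      qed
      also have "\<dots> \<le> K * (d2 + a22 * v x)"
        using K a nn(2)[OF x'] by (intro mult_left_mono) auto
      finally have "(a2 * u x + v x - 1) * v x \<le> K * (d2 + a22 * v x) * v x"
        using nn(2)[OF x'] by (rule mult_right_mono)
      then show ?thesis unfolding lapQ[OF x] Q_def by (simp add: algebra_simps)
    qed
    show "neumann_touching_ball \<Omega> Q p" if "p \<in> frontier \<Omega>" for p
      using touch ndQ that by blast
    show "Q xv \<noteq> 0"
      unfolding Q_def using xv nn(2)[of xv] closure_subset[of \<Omega>] d a
      by (smt (verit) mult_eq_0_iff mult_nonneg_nonneg subsetD)
  qed
  \<comment> \<open>Positivity allows division by \<open>v x1\<close> below; with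
    \<open>v x1 = 0\<close> the minimum principle would only say \<open>0 \<le> 0\<close>.\<close>
  then have v1: "v x1 > 0" using nn(2)[OF x1(1)] by (cases "v x1 = 0") (auto simp: Q_def)
  have min_v: "a2 * u x1 + v x1 \<ge> 1"
  proof -
    have "0 \<le> - (v x1 * (1 - a2 * u x1 - v x1))"
    proof (rule neumann_min_laplacian_nonneg[OF \<Omega>(1) x1(1) contQ _ _ C2Q lapQ])
      show "continuous_on (closure \<Omega>) (\<lambda>x. - (v x * (1 - a2 * u x - v x)))"
        by (intro continuous_intros cont)
      show "Q x1 \<le> Q x" if "x \<in> closure \<Omega>" for x
        unfolding Q_def using x1(2)[OF that] v1 d a
        by (intro mult_mono add_mono mult_left_mono) auto
      show "neumann_touching_ball \<Omega> Q x1" if "x1 \<in> frontier \<Omega>"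
        using touch ndQ that by blast
    qed
    then have "v x1 * (1 - a2 * u x1 - v x1) \<le> 0" by simp
    then show ?thesis using v1 by (simp add: mult_le_0_iff)
  qed
  \<comment> \<open>Since \<open>u x0 > 0\<close>, the factor \<open>a2 < 1\<close> makes the chain
    strict: \<open>1 \<le> a2 * u x0 + v x0 < u x0 + a1 * v x0 \<le> 1\<close>.\<close>
  have "a2 * u x1 \<le> a2 * u x0" using x0(2)[OF x1(1)] a2 by simp
  moreover have "a2 * u x0 < u x0" using a2 u0 by simp
  moreover have "v x1 \<le> v x0" using x1(2)[OF x0(1)] .
  moreover have "v x0 \<le> a1 * v x0" using a1 nn(2)[OF x0(1)] mult_right_mono[of 1 a1 "v x0"] by simp
  ultimately show False using max_u min_v by linarith
qed

theorem theorem3p1: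
  fixes \<Omega> :: "'a::euclidean_space set"
    and \<nu> :: "'a \<Rightarrow> 'a"
    and u v :: "'a \<Rightarrow> real"
    and a1 a2 d1 d2 a11 a22 :: real
  assumes "smooth_bounded_domain \<Omega>"
    and "\<forall>x\<in>frontier \<Omega>. outward_unit_normal \<Omega> x (\<nu> x)"
    and "a1 > 0" and "a2 > 0" and "d1 > 0" and "d2 > 0" and "a11 \<ge> 0" and "a22 \<ge> 0"
    and "nonneg_classical_solution \<Omega> \<nu> d1 d2 a11 a22 a1 a2 u v"
    and "(a1 > 1 \<and> 1 > a2 \<and> d1 > d2 \<and> d1 \<ge> d2 + 2 * a22) \<or>
         (a1 < 1 \<and> 1 < a2 \<and> d1 < d2 \<and> d2 \<ge> d1 + 2 * a11)"
  shows "(\<forall>x\<in>\<Omega>. u x = 0) \<or> (\<forall>x\<in>\<Omega>. v x = 0)"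
  using assms(10)
proof
  assume "a1 > 1 \<and> 1 > a2 \<and> d1 > d2 \<and> d1 \<ge> d2 + 2 * a22"
  then show ?thesis using no_coexistence[OF assms(1,2,5-8,4) _ _ assms(9)] by blast
next
  assume "a1 < 1 \<and> 1 < a2 \<and> d1 < d2 \<and> d2 \<ge> d1 + 2 * a11"
  then show ?thesis
    using no_coexistence[OF assms(1,2,6,5,8,7,3) _ _ nonneg_classical_solution_swap[OF assms(9)]]
    by blast
qed

end
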